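(* Let $(M^4,g)$ be a Riemannian $4$-manifold, $p\in M$, and $k\in\mathbb{R}$. Let $R$ be the curvature operator at $p$, written in canonical form with components $u\in\mathbb{R}$, $\vec w_\pm=(w_1^\pm,w_2^\pm,w_3^\pm)\in\mathbb{R}^3$ and $C\in\mathrm{Mat}_{3\times3}(\mathbb{R})$ (see context). (i) If either all $2$-planes in $T_pM$ have $\sec\ge k$, or all $2$-planes in $T_pM$ have $\sec\le k$, then $$|C|^2\le3(u-k)^2+\langle\vec w_+,\vec w_-\rangle.$$ (ii) If $t\in\mathbb{R}$ is such that $R-k\,\mathrm{Id}+t\,*\succeq0$ on $\wedge^2T_pM$, or such that $-(R-k\,\mathrm{Id})+t\,*\succeq0$ on $\wedge^2T_pM$, then $$|C|^2\le3(u-k)^2-3t^2+\langle\vec w_+,\vec w_-\rangle.$$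
   Context: Identify $T_pM$ isometrically with (oriented) $\mathbb{R}^4$. The curvature operator is the symmetric endomorphism $R$ of $\wedge^2T_pM$ with $\sec(\Pi)=\langle R(\alpha),\alpha\rangle$ for $\alpha=v\wedge w$, $v,w$ an orthonormal basis of $\Pi$. Let $*$ be the Hodge star on $\wedge^2\mathbb{R}^4$, with $\pm1$-eigenspaces $\wedge^2_\pm\mathbb{R}^4$. Canonical form: with respect to suitable orthonormal bases of $\wedge^2_+\mathbb{R}^4$ and $\wedge^2_-\mathbb{R}^4$, $$R=\begin{pmatrix}u\,\mathrm{Id}+W_+ & C^{\mathrm t}\\ C & u\,\mathrm{Id}+W_-\end{pmatrix},$$ where $u=\frac16\operatorname{tr}R=\frac1{12}\mathrm{scal}$, $W_\pm=\mathrm{diag}(w_1^\pm,w_2^\pm,w_3^\pm)$ with $w_1^\pm\le w_2^\pm\le w_3^\pm$ and $w_1^\pm+w_2^\pm+w_3^\pm=0$, and $C$ is a $3\times3$ matrix (encoding the traceless Ricci part). $|C|^2=\sum_{i,j}c_{ij}^2$, $\langle\cdot,\cdot\rangle$ is the Euclidean inner product of $\mathbb{R}^3$, and $A\succeq0$ means that $A$ is positive-semidefinite. *)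

theory Defs
  imports "HOL-Analysis.Analysis"
begin

section \<open>Riemannian 4-manifolds\<close>

text \<open>
  Continuous differentiability of order n on an open set, by iterated directional derivatives.
\<close>

primrec cdiff_on ::
  "nat \<Rightarrow> 'a::real_normed_vector set \<Rightarrow> ('a \<Rightarrow> 'b::real_normed_vector) \<Rightarrow> bool" where
  "cdiff_on 0 S f \<longleftrightarrow> continuous_on S f"
| "cdiff_on (Suc n) S f \<longleftrightarrow>
     (\<forall>x\<in>S. f differentiable (at x)) \<and>
     (\<forall>v. cdiff_on n S (\<lambda>x. frechet_derivative f (at x) v))"

definition smooth_on ::
  "'a::real_normed_vector set \<Rightarrow> ('a \<Rightarrow> 'b::real_normed_vector) \<Rightarrow> bool" where
  "smooth_on S f \<longleftrightarrow> (\<forall>n. cdiff_on n S f)"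

text \<open>A chart is a pair of a domain and a coordinate map on it.\<close>

type_synonym 'a chart = "'a set \<times> ('a \<Rightarrow> real^4)"

definition transition :: "'a chart \<Rightarrow> 'a chart \<Rightarrow> real^4 \<Rightarrow> real^4" where
  "transition c d = snd d \<circ> the_inv_into (fst c) (snd c)"

definition smooth_4_manifold :: "'a topology \<Rightarrow> 'a chart set \<Rightarrow> bool" where
  "smooth_4_manifold X \<A> \<longleftrightarrow>
     Hausdorff_space X \<and> second_countable X \<and>
     (\<Union>c\<in>\<A>. fst c) = topspace X \<and>
     (\<forall>(U, \<phi>)\<in>\<A>. openin X U \<and> open (\<phi> ` U) \<and>
        homeomorphic_map (subtopology X U) (top_of_set (\<phi> ` U)) \<phi>) \<and>
     (\<forall>c\<in>\<A>. \<forall>d\<in>\<A>. smooth_on (snd c ` (fst c \<inter> fst d)) (transition c d))"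

definition gram :: "real^4^4 \<Rightarrow> real^4 \<Rightarrow> real^4 \<Rightarrow> real" where
  "gram G v w = v \<bullet> (G *v w)"

text \<open>
  A Riemannian metric is given by its component matrices: \<open>g c x $ i $ j\<close> is the inner product
  of the i-th and j-th coordinate vector fields of the chart \<open>c\<close> at the point with coordinates
  \<open>x\<close>.  The last clause is the transformation law making this a well-defined tensor field.
\<close>

definition riemannian_4_manifold ::
  "'a topology \<Rightarrow> 'a chart set \<Rightarrow> ('a chart \<Rightarrow> real^4 \<Rightarrow> real^4^4) \<Rightarrow> bool" where
  "riemannian_4_manifold X \<A> g \<longleftrightarrow>
     smooth_4_manifold X \<A> \<and>
     (\<forall>c\<in>\<A>. smooth_on (snd c ` fst c) (g c)) \<and>
     (\<forall>c\<in>\<A>. \<forall>x\<in>snd c ` fst c.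
        transpose (g c x) = g c x \<and> (\<forall>v. v \<noteq> 0 \<longrightarrow> gram (g c x) v v > 0)) \<and>
     (\<forall>c\<in>\<A>. \<forall>d\<in>\<A>. \<forall>x\<in>snd c ` (fst c \<inter> fst d). \<forall>v w.
        gram (g c x) v w =
        gram (g d (transition c d x))
          (frechet_derivative (transition c d) (at x) v)
          (frechet_derivative (transition c d) (at x) w))"


section \<open>Curvature in a chart\<close>

text \<open>
  Below, \<open>G\<close> is the matrix of metric components in a chart, and a tangent vector at the point with
  coordinates \<open>x\<close> is represented by its components with respect to the coordinate vector fields.
\<close>

definition pderiv_at :: "4 \<Rightarrow> (real^4 \<Rightarrow> real) \<Rightarrow> real^4 \<Rightarrow> real" where
  "pderiv_at i f x = frechet_derivative f (at x) (axis i 1)"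

text \<open>\<open>christoffel G x l i j\<close> has upper index \<open>l\<close> and lower indices \<open>i\<close>, \<open>j\<close>.\<close>

definition christoffel :: "(real^4 \<Rightarrow> real^4^4) \<Rightarrow> real^4 \<Rightarrow> 4 \<Rightarrow> 4 \<Rightarrow> 4 \<Rightarrow> real" where
  "christoffel G x l i j =
     (1/2) * (\<Sum>m\<in>UNIV. matrix_inv (G x) $ l $ m *
       (pderiv_at i (\<lambda>y. G y $ j $ m) x + pderiv_at j (\<lambda>y. G y $ i $ m) x
        - pderiv_at m (\<lambda>y. G y $ i $ j) x))"

text \<open>
  The coefficient of the l-th coordinate field in
  \<open>\<nabla>\<^sub>i \<nabla>\<^sub>j \<partial>\<^sub>k - \<nabla>\<^sub>j \<nabla>\<^sub>i \<partial>\<^sub>k\<close>, for the Levi-Civita connection.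
\<close>

definition riemann_coeff ::
  "(real^4 \<Rightarrow> real^4^4) \<Rightarrow> real^4 \<Rightarrow> 4 \<Rightarrow> 4 \<Rightarrow> 4 \<Rightarrow> 4 \<Rightarrow> real" where
  "riemann_coeff G x l i j k =
     pderiv_at i (\<lambda>y. christoffel G y l j k) x - pderiv_at j (\<lambda>y. christoffel G y l i k) x
     + (\<Sum>m\<in>UNIV. christoffel G x l i m * christoffel G x m j k
                 - christoffel G x l j m * christoffel G x m i k)"

definition riemann_endo ::
  "(real^4 \<Rightarrow> real^4^4) \<Rightarrow> real^4 \<Rightarrow> real^4 \<Rightarrow> real^4 \<Rightarrow> real^4 \<Rightarrow> real^4" where
  "riemann_endo G x X Y Z =
     (\<chi> l. \<Sum>i\<in>UNIV. \<Sum>j\<in>UNIV. \<Sum>k\<in>UNIV. riemann_coeff G x l i j k * X $ i * Y $ j * Z $ k)"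

definition riemann_tensor ::
  "(real^4 \<Rightarrow> real^4^4) \<Rightarrow> real^4 \<Rightarrow> real^4 \<Rightarrow> real^4 \<Rightarrow> real^4 \<Rightarrow> real^4 \<Rightarrow> real" where
  "riemann_tensor G x X Y Z W = gram (G x) (riemann_endo G x X Y Z) W"

text \<open>The sectional curvature of the plane spanned by linearly independent \<open>X\<close> and \<open>Y\<close>.\<close>

definition sec :: "(real^4 \<Rightarrow> real^4^4) \<Rightarrow> real^4 \<Rightarrow> real^4 \<Rightarrow> real^4 \<Rightarrow> real" where
  "sec G x X Y =
     riemann_tensor G x X Y Y X /
       (gram (G x) X X * gram (G x) Y Y - (gram (G x) X Y)\<^sup>2)"

definition sec_ge :: "(real^4 \<Rightarrow> real^4^4) \<Rightarrow> real^4 \<Rightarrow> real \<Rightarrow> bool" where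
  "sec_ge G x k \<longleftrightarrow> (\<forall>X Y. X \<noteq> Y \<and> independent {X, Y} \<longrightarrow> sec G x X Y \<ge> k)"

definition sec_le :: "(real^4 \<Rightarrow> real^4^4) \<Rightarrow> real^4 \<Rightarrow> real \<Rightarrow> bool" where
  "sec_le G x k \<longleftrightarrow> (\<forall>X Y. X \<noteq> Y \<and> independent {X, Y} \<longrightarrow> sec G x X Y \<le> k)"


section \<open>Bivectors\<close>

text \<open>
  The second exterior power of \<open>\<real>\<^sup>4\<close> is modelled by the skew-symmetric matrices.  The inner
  product is half of the Frobenius one, so that \<open>v \<and> w\<close> is a unit vector for orthonormal
  \<open>v\<close>, \<open>w\<close>.
\<close>

definition bivectors :: "(real^4^4) set" where
  "bivectors = {A. transpose A = - A}"

definition wedge :: "real^4 \<Rightarrow> real^4 \<Rightarrow> real^4^4" where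
  "wedge v w = (\<chi> i j. v $ i * w $ j - v $ j * w $ i)"

definition bivec_inner :: "real^4^4 \<Rightarrow> real^4^4 \<Rightarrow> real" where
  "bivec_inner A B = (A \<bullet> B) / 2"

text \<open>
  On the standard basis, the Hodge star exchanges \<open>e\<^sub>1 \<and> e\<^sub>2\<close> with \<open>e\<^sub>3 \<and> e\<^sub>4\<close>,
  \<open>e\<^sub>1 \<and> e\<^sub>3\<close> with \<open>- e\<^sub>2 \<and> e\<^sub>4\<close>, and \<open>e\<^sub>1 \<and> e\<^sub>4\<close> with \<open>e\<^sub>2 \<and> e\<^sub>3\<close>.
\<close>

definition hodge_star :: "real^4^4 \<Rightarrow> real^4^4" where
  "hodge_star A =
     (let e = (\<lambda>i. axis i 1) :: 4 \<Rightarrow> real^4 in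
        A $ 1 $ 2 *\<^sub>R wedge (e 3) (e 4) - A $ 1 $ 3 *\<^sub>R wedge (e 2) (e 4)
      + A $ 1 $ 4 *\<^sub>R wedge (e 2) (e 3) + A $ 2 $ 3 *\<^sub>R wedge (e 1) (e 4)
      - A $ 2 $ 4 *\<^sub>R wedge (e 1) (e 3) + A $ 3 $ 4 *\<^sub>R wedge (e 1) (e 2))"

definition bivectors_plus :: "(real^4^4) set" where
  "bivectors_plus = {A \<in> bivectors. hodge_star A = A}"

definition bivectors_minus :: "(real^4^4) set" where
  "bivectors_minus = {A \<in> bivectors. hodge_star A = - A}"

definition psd_on_bivectors :: "(real^4^4 \<Rightarrow> real^4^4) \<Rightarrow> bool" where
  "psd_on_bivectors S \<longleftrightarrow> (\<forall>A\<in>bivectors. bivec_inner (S A) A \<ge> 0)"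

definition orthonormal_basis_of :: "(real^4^4) set \<Rightarrow> (3 \<Rightarrow> real^4^4) \<Rightarrow> bool" where
  "orthonormal_basis_of V e \<longleftrightarrow>
     span (range e) = V \<and> (\<forall>i j. bivec_inner (e i) (e j) = (if i = j then 1 else 0))"


section \<open>The curvature operator and its canonical form\<close>

text \<open>An isometric identification of Euclidean 4-space with a tangent space with Gram matrix \<open>G\<close>.\<close>

definition tangent_isometry :: "real^4^4 \<Rightarrow> (real^4 \<Rightarrow> real^4) \<Rightarrow> bool" where
  "tangent_isometry G E \<longleftrightarrow> linear E \<and> (\<forall>v w. gram G (E v) (E w) = v \<bullet> w)"

text \<open>
  The curvature operator, transported to the bivectors of \<open>\<real>\<^sup>4\<close> along an isometric identification
  \<open>E\<close> with the tangent space.  This determines \<open>R\<close> uniquely on \<open>bivectors\<close>; its values on other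
  matrices are immaterial.  The order of the last two arguments of \<open>riemann_tensor\<close> makes the
  sectional curvature of the plane with orthonormal basis \<open>E v\<close>, \<open>E w\<close> equal to
  \<open>bivec_inner (R (wedge v w)) (wedge v w)\<close>.
\<close>

definition is_curvature_operator ::
  "(real^4 \<Rightarrow> real^4^4) \<Rightarrow> real^4 \<Rightarrow> (real^4 \<Rightarrow> real^4) \<Rightarrow> (real^4^4 \<Rightarrow> real^4^4) \<Rightarrow> bool" where
  "is_curvature_operator G x E R \<longleftrightarrow>
     linear R \<and> R ` bivectors \<subseteq> bivectors \<and>
     (\<forall>v w v' w'. bivec_inner (R (wedge v w)) (wedge v' w') =
        riemann_tensor G x (E v) (E w) (E w') (E v'))"

text \<open>
  With respect to orthonormal bases \<open>e\<close> of the self-dual and \<open>f\<close> of the anti-self-dual bivectors,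
  \<open>R\<close> has diagonal blocks \<open>u Id + diag w\<^sub>+\<close>, \<open>u Id + diag w\<^sub>-\<close> and off-diagonal blocks \<open>C\<close> (lower
  left) and its transpose (upper right).  As the entries of \<open>w\<^sub>+\<close> and of \<open>w\<^sub>-\<close> sum to zero, the
  trace of \<open>R\<close> is \<open>6 u\<close>.
\<close>

definition canonical_form ::
  "(real^4^4 \<Rightarrow> real^4^4) \<Rightarrow> real \<Rightarrow> real^3 \<Rightarrow> real^3 \<Rightarrow> real^3^3 \<Rightarrow> bool" where
  "canonical_form R u wp wm C \<longleftrightarrow>
     wp $ 1 \<le> wp $ 2 \<and> wp $ 2 \<le> wp $ 3 \<and> wp $ 1 + wp $ 2 + wp $ 3 = 0 \<and>
     wm $ 1 \<le> wm $ 2 \<and> wm $ 2 \<le> wm $ 3 \<and> wm $ 1 + wm $ 2 + wm $ 3 = 0 \<and>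
     (\<exists>e f. orthonormal_basis_of bivectors_plus e \<and> orthonormal_basis_of bivectors_minus f \<and>
        (\<forall>j. R (e j) = (u + wp $ j) *\<^sub>R e j + (\<Sum>i\<in>UNIV. C $ i $ j *\<^sub>R f i)) \<and>
        (\<forall>j. R (f j) = (\<Sum>i\<in>UNIV. C $ j $ i *\<^sub>R e i) + (u + wm $ j) *\<^sub>R f j))"

end

theory Submission
  imports Defs
begin

text \<open>
  Part (i) reduces to part (ii) by the Finsler--Thorpe trick: the planes are the null directions of
  the quadratic form of \<open>*\<close>, so a form that is nonnegative on planes becomes positive-semidefinite
  after adding a suitable multiple of \<open>*\<close>.  For part (ii), the shifted operator has diagonal blocks
  \<open>diag a\<close>, \<open>diag b\<close> with \<open>a\<close> and \<open>b\<close> similarly ordered.  Positive-semidefiniteness makes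
  \<open>c\<^sub>i\<^sub>j\<^sup>2 / (b\<^sub>i a\<^sub>j)\<close> a doubly substochastic matrix, and the rearrangement inequality bounds
  \<open>|C|\<^sup>2\<close> by the sum of the \<open>a\<^sub>i b\<^sub>i\<close>; as \<open>w\<^sub>+\<close> and \<open>w\<^sub>-\<close> have zero sums, this is the claimed bound.
\<close>

section \<open>Substochastic matrices and block matrices\<close>

text \<open>A fractional knapsack bound. With q the indicator of \<open>S\<close> and \<beta> the
  least value of \<open>b\<close> on \<open>S\<close>, the factors r - q and b - \<beta> never have
  the same strict sign, so \<open>b\<close> may be replaced by \<beta>. The total of r - q is at
  most 0, and \<beta> is nonnegative.\<close>

lemma weighted_sum_le_sum_top:
  fixes b r :: "'n::finite \<Rightarrow> real"
  assumes b: "\<And>i. 0 \<le> b i" and top: "\<And>i k. i \<in> S \<Longrightarrow> k \<notin> S \<Longrightarrow> b k \<le> b i"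
    and r: "\<And>i. 0 \<le> r i" "\<And>i. r i \<le> 1" and sum_r: "sum r UNIV \<le> real (card S)"
  shows "(\<Sum>i\<in>UNIV. r i * b i) \<le> sum b S"
proof (cases "S = {}")
  case True
  then have "sum r UNIV = 0"
    using sum_r r(1) by (simp add: order_antisym sum_nonneg)
  then have "\<And>i. r i = 0"
    using r(1) by (simp add: sum_nonneg_eq_0_iff)
  then show ?thesis using True by simp
next
  case False
  define \<beta> where "\<beta> = Min (b ` S)"
  have "\<beta> \<in> b ` S" unfolding \<beta>_def using False by (intro Min_in) auto
  then obtain i0 where i0: "i0 \<in> S" "\<beta> = b i0" by auto
  have \<beta>S: "\<beta> \<le> b i" if "i \<in> S" for i unfolding \<beta>_def using that by (intro Min_le) auto
  have \<beta>0: "0 \<le> \<beta>" using b i0 by simp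
  define q where "q i = (if i \<in> S then 1 else 0::real)" for i
  have "(r i - q i) * b i \<le> (r i - q i) * \<beta>" for i
  proof (cases "i \<in> S")
    case True
    then show ?thesis using r(2)[of i] \<beta>S[of i] by (intro mult_left_mono_neg) (auto simp: q_def)
  next
    case False
    then show ?thesis using r(1)[of i] top[of i0 i] i0 by (intro mult_left_mono) (auto simp: q_def)
  qed
  then have "(\<Sum>i\<in>UNIV. (r i - q i) * b i) \<le> (\<Sum>i\<in>UNIV. (r i - q i) * \<beta>)"
    by (intro sum_mono)
  also have "\<dots> = (sum r UNIV - sum q UNIV) * \<beta>"
    by (simp add: sum_distrib_right[symmetric] sum_subtractf)
  also have "sum q UNIV = card S" by (simp add: q_def sum.If_cases)
  also have "(sum r UNIV - card S) * \<beta> \<le> 0" using sum_r \<beta>0 by (simp add: mult_nonpos_nonneg)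
  finally have "(\<Sum>i\<in>UNIV. r i * b i) \<le> (\<Sum>i\<in>UNIV. q i * b i)"
    by (simp add: left_diff_distrib sum_subtractf)
  also have "\<dots> = sum b S"
    by (simp add: q_def if_distrib[of "\<lambda>x. x * _"] sum.If_cases cong: if_cong)
  finally show ?thesis .
qed

text \<open>Induction on the support of \<open>a\<close>, peeling off multiples of its indicator function.\<close>

lemma substochastic_rearrangement:
  fixes a b :: "'n::finite \<Rightarrow> real" and D :: "'n \<Rightarrow> 'n \<Rightarrow> real"
  assumes "\<And>i. 0 \<le> a i" "\<And>i. 0 \<le> b i" "\<And>i j. a i < a j \<Longrightarrow> b i \<le> b j"
    and D: "\<And>i j. 0 \<le> D i j" "\<And>i. (\<Sum>j\<in>UNIV. D i j) \<le> 1" "\<And>j. (\<Sum>i\<in>UNIV. D i j) \<le> 1"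
  shows "(\<Sum>i\<in>UNIV. \<Sum>j\<in>UNIV. D i j * b i * a j) \<le> (\<Sum>i\<in>UNIV. a i * b i)"
  using assms(1-3)
proof (induction "card {i. a i > 0}" arbitrary: a rule: less_induct)
  case less
  note a = less.prems(1) and b = less.prems(2) and vary = less.prems(3)
  define S where "S = {i. a i > 0}"
  have a0: "a i = 0" if "i \<notin> S" for i using that a[of i] by (simp add: S_def)
  show ?case
  proof (cases "S = {}")
    case True
    then have "\<And>i. a i = 0" using a0 by simp
    then show ?thesis by simp
  next
    case False
    define m where "m = Min (a ` S)"
    have "m \<in> a ` S" unfolding m_def using False by (intro Min_in) auto
    then obtain i0 where i0: "i0 \<in> S" "m = a i0" by auto
    have mS: "m \<le> a i" if "i \<in> S" for i unfolding m_def using that by (intro Min_le) auto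
    have m0: "0 < m" using i0 by (simp add: S_def)
    define a' where "a' i = (if i \<in> S then a i - m else 0)" for i
    have a_eq: "a i = a' i + m * (if i \<in> S then 1 else 0)" for i
      using a0[of i] by (simp add: a'_def)
    have a'0: "0 \<le> a' i" for i using mS by (simp add: a'_def)
    \<comment> \<open>The index \<open>i0\<close>, where the minimum is attained, leaves the
      support.\<close>
    have "{i. a' i > 0} \<subset> S"
      using i0 by (auto simp: a'_def split: if_splits)
    then have card: "card {i. a' i > 0} < card {i. a i > 0}"
      unfolding S_def[symmetric] by (intro psubset_card_mono) auto
    have vary': "b i \<le> b j" if "a' i < a' j" for i j
    proof (intro vary)
      show "a i < a j"
        using that a'0[of i] m0 by (simp add: a_eq) (auto simp: a'_def split: if_splits)
    qed
    have IH: "(\<Sum>i\<in>UNIV. \<Sum>j\<in>UNIV. D i j * b i * a' j) \<le> (\<Sum>i\<in>UNIV. a' i * b i)"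
      by (rule less.hyps[OF card a'0 b vary'])
    have "(\<Sum>i\<in>UNIV. (\<Sum>j\<in>S. D i j) * b i) \<le> sum b S"
    proof (rule weighted_sum_le_sum_top[OF b])
      \<comment> \<open>Outside the support \<open>a\<close> is 0, hence strictly smaller than
        inside, so \<open>S\<close> carries the largest values of \<open>b\<close>. Below, the row
        sums of \<open>D\<close> bound each weight by 1 and the column sums bound the total weight
        by \<open>card S\<close>.\<close>
      show "b k \<le> b i" if "i \<in> S" "k \<notin> S" for i k
        using vary[of k i] a0[of k] that by (simp add: S_def)
      show "0 \<le> (\<Sum>j\<in>S. D i j)" for i by (simp add: D(1) sum_nonneg)
      have "(\<Sum>j\<in>S. D i j) \<le> (\<Sum>j\<in>UNIV. D i j)" for i
        by (rule sum_mono2) (auto simp: D(1))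
      then show "(\<Sum>j\<in>S. D i j) \<le> 1" for i using D(2) order_trans by blast
      have "(\<Sum>i\<in>UNIV. \<Sum>j\<in>S. D i j) = (\<Sum>j\<in>S. \<Sum>i\<in>UNIV. D i j)" by (rule sum.swap)
      also have "\<dots> \<le> (\<Sum>j\<in>S. 1)" by (intro sum_mono D(3))
      finally show "(\<Sum>i\<in>UNIV. \<Sum>j\<in>S. D i j) \<le> real (card S)" by simp
    qed
    then have top: "m * (\<Sum>i\<in>UNIV. (\<Sum>j\<in>S. D i j) * b i) \<le> m * sum b S"
      using m0 by (intro mult_left_mono) auto
    have "(\<Sum>j\<in>UNIV. D i j * b i * a j) =
        (\<Sum>j\<in>UNIV. D i j * b i * a' j) + m * ((\<Sum>j\<in>S. D i j) * b i)" for i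
    proof -
      have "D i j * b i * a j = D i j * b i * a' j + (if j \<in> S then m * (D i j * b i) else 0)" for j
        by (simp add: a_eq algebra_simps)
      then show ?thesis
        by (simp add: sum.distrib sum.If_cases sum_distrib_left sum_distrib_right)
    qed
    then have "(\<Sum>i\<in>UNIV. \<Sum>j\<in>UNIV. D i j * b i * a j) =
        (\<Sum>i\<in>UNIV. \<Sum>j\<in>UNIV. D i j * b i * a' j) + m * (\<Sum>i\<in>UNIV. (\<Sum>j\<in>S. D i j) * b i)"
      by (simp add: sum.distrib sum_distrib_left)
    also have "\<dots> \<le> (\<Sum>i\<in>UNIV. a' i * b i) + m * sum b S"
      using IH top by simp
    also have "\<dots> = (\<Sum>i\<in>UNIV. a i * b i)"
    proof -
      have "a i * b i = a' i * b i + (if i \<in> S then m * b i else 0)" for i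
        by (simp add: a_eq algebra_simps)
      then show ?thesis by (simp add: sum.distrib sum.If_cases sum_distrib_left)
    qed
    finally show ?thesis .
  qed
qed

section \<open>Positive-semidefinite block matrices with diagonal blocks on the diagonal\<close>

text \<open>The quadratic form of the symmetric matrix with blocks diag a and diag b, and with c as
  lower left block.\<close>

definition block_form :: "('m \<Rightarrow> real) \<Rightarrow> ('n \<Rightarrow> real) \<Rightarrow> ('n \<Rightarrow> 'm \<Rightarrow> real) \<Rightarrow>
    ('m::finite \<Rightarrow> real) \<Rightarrow> ('n::finite \<Rightarrow> real) \<Rightarrow> real" where
  "block_form a b c x y = (\<Sum>j\<in>UNIV. a j * (x j)\<^sup>2) + (\<Sum>i\<in>UNIV. b i * (y i)\<^sup>2)
     + 2 * (\<Sum>i\<in>UNIV. \<Sum>j\<in>UNIV. c i j * y i * x j)"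

lemma block_form_swap: "block_form a b c x y = block_form b a (\<lambda>i j. c j i) y x"
proof -
  have "(\<Sum>i\<in>UNIV. \<Sum>j\<in>UNIV. c i j * y i * x j) = (\<Sum>i\<in>UNIV. \<Sum>j\<in>UNIV. c j i * x i * y j)"
    by (subst sum.swap) (simp add: mult_ac)
  then show ?thesis by (simp add: block_form_def)
qed

lemma block_form_single:
  "block_form a b c (\<lambda>k. if k = j then r else 0) y
     = a j * r\<^sup>2 + (\<Sum>i\<in>UNIV. b i * (y i)\<^sup>2) + 2 * r * (\<Sum>i\<in>UNIV. c i j * y i)"
proof -
  have "(\<Sum>k\<in>UNIV. a k * (if k = j then r else 0)\<^sup>2) = (\<Sum>k\<in>UNIV. if k = j then a j * r\<^sup>2 else 0)"
    by (rule sum.cong) auto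
  moreover have "(\<Sum>k\<in>UNIV. c i k * y i * (if k = j then r else 0))
      = (\<Sum>k\<in>UNIV. if k = j then c i j * y i * r else 0)" for i
    by (rule sum.cong) auto
  ultimately show ?thesis
    by (simp add: block_form_def sum_distrib_left sum_distrib_right mult_ac)
qed

lemma psd_block_diag_nonneg:
  assumes "\<And>x y. 0 \<le> block_form a b c x y"
  shows "0 \<le> a j"
  using assms[of "\<lambda>k. if k = j then 1 else 0" "\<lambda>_. 0"] by (simp only: block_form_single) simp

text \<open>If \<open>b i\<close> vanishes, the form is affine in the i-th entry \<open>s\<close> of
  \<open>y\<close>; an affine function bounded below has slope zero.\<close>

lemma psd_block_zero:
  assumes psd: "\<And>x y. 0 \<le> block_form a b c x y" and "b i = 0"
  shows "c i j = 0"
proof -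
  have "0 \<le> a j + 2 * (c i j * s)" for s
    using psd[of "\<lambda>k. if k = j then 1 else 0" "\<lambda>k. if k = i then s else 0"] \<open>b i = 0\<close>
    by (simp only: block_form_single)
      (simp add: if_distrib[of "\<lambda>x. x ^ 2"] if_distrib[of "\<lambda>x. _ * x"] cong: if_cong)
  \<comment> \<open>For nonzero slope this \<open>s\<close> gives the value - a j - 2, which is
    negative.\<close>
  from this[of "- (a j + 1) / c i j"] psd_block_diag_nonneg[OF psd, of j] show ?thesis
    by (cases "c i j = 0") auto
qed

text \<open>A row with \<open>b i = 0\<close> vanishes by the previous lemma, so its contribution \<open>0 / 0 = 0\<close> is the right one.\<close>

lemma psd_block_column_le:
  assumes psd: "\<And>x y. 0 \<le> block_form a b c x y"
  shows "(\<Sum>i\<in>UNIV. (c i j)\<^sup>2 / b i) \<le> a j"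
proof -
  have "(\<Sum>i\<in>UNIV. b i * (- c i j / b i)\<^sup>2) = (\<Sum>i\<in>UNIV. (c i j)\<^sup>2 / b i)"
    by (rule sum.cong) (auto simp: power2_eq_square)
  moreover have "(\<Sum>i\<in>UNIV. c i j * (- c i j / b i)) = - (\<Sum>i\<in>UNIV. (c i j)\<^sup>2 / b i)"
    by (simp add: power2_eq_square sum_negf)
  ultimately show ?thesis
    \<comment> \<open>With \<open>x\<close> the j-th unit vector, this \<open>y\<close> minimises
      the form; the minimum is the Schur complement of diag b.\<close>
    using psd[of "\<lambda>k. if k = j then 1 else 0" "\<lambda>i. - c i j / b i"]
    by (simp only: block_form_single) simp
qed

lemma psd_block_offdiag_bound:
  fixes a b :: "'n::finite \<Rightarrow> real"
  assumes psd: "\<And>x y. 0 \<le> block_form a b c x y"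
    and vary: "\<And>i j. a i < a j \<Longrightarrow> b i \<le> b j"
  shows "(\<Sum>i\<in>UNIV. \<Sum>j\<in>UNIV. (c i j)\<^sup>2) \<le> (\<Sum>i\<in>UNIV. a i * b i)"
proof -
  \<comment> \<open>Swapping the blocks turns each fact about \<open>a\<close> and columns of
    \<open>c\<close> into one about \<open>b\<close> and rows.\<close>
  have psd': "0 \<le> block_form b a (\<lambda>i j. c j i) x y" for x y
    using psd[of y x] by (simp add: block_form_swap[of a b c])
  note a = psd_block_diag_nonneg[OF psd] and b = psd_block_diag_nonneg[OF psd']
  define D where "D i j = (c i j)\<^sup>2 / (b i * a j)" for i j
  \<comment> \<open>If \<open>b i\<close> or \<open>a j\<close> is 0, then \<open>D i j\<close> is 0
    by the convention for division, and \<open>c i j\<close> vanishes as well.\<close>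
  have eq: "(c i j)\<^sup>2 = D i j * b i * a j" for i j
    using psd_block_zero[OF psd, of i j] psd_block_zero[OF psd', of j i]
    by (cases "a j = 0"; cases "b i = 0") (auto simp: D_def)
  have "(\<Sum>i\<in>UNIV. \<Sum>j\<in>UNIV. D i j * b i * a j) \<le> (\<Sum>i\<in>UNIV. a i * b i)"
  proof (rule substochastic_rearrangement[OF a b vary])
    show "0 \<le> D i j" for i j using a b by (simp add: D_def)
    show "(\<Sum>j\<in>UNIV. D i j) \<le> 1" for i
    proof -
      have "(\<Sum>j\<in>UNIV. D i j) = (\<Sum>j\<in>UNIV. (c i j)\<^sup>2 / a j) / b i"
        by (simp add: D_def sum_divide_distrib mult.commute)
      also have "\<dots> \<le> 1"
        using psd_block_column_le[OF psd', of i] b[of i] by (cases "b i = 0") (auto simp: divide_simps)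
      finally show ?thesis .
    qed
    show "(\<Sum>i\<in>UNIV. D i j) \<le> 1" for j
    proof -
      have "(\<Sum>i\<in>UNIV. D i j) = (\<Sum>i\<in>UNIV. (c i j)\<^sup>2 / b i) / a j"
        by (simp add: D_def sum_divide_distrib)
      also have "\<dots> \<le> 1"
        using psd_block_column_le[OF psd, of j] a[of j] by (cases "a j = 0") (auto simp: divide_simps)
      finally show ?thesis .
    qed
  qed
  then show ?thesis by (simp add: eq)
qed

section \<open>The Finsler--Thorpe trick\<close>

lemma bilinear_line_expand:
  assumes "bilinear B"
  shows "B (v + s *\<^sub>R w) (v + s *\<^sub>R w) = B v v + s * (B v w + B w v) + s\<^sup>2 * (B w w :: real)"
  using assms
  by (simp add: bilinear_ladd bilinear_radd bilinear_lmul bilinear_rmul power2_eq_square algebra_simps)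

text \<open>
  The line through \<open>v\<close> in direction \<open>w\<close> meets the null cone of \<open>P\<close> at two parameters \<open>s1 > 0 > s2\<close>;
  the combination of the values of \<open>Q\<close> there with weights \<open>-s2\<close>, \<open>s1\<close> eliminates the mixed term.
\<close>

lemma finsler_aux:
  fixes P Q :: "'a::real_vector \<Rightarrow> 'a \<Rightarrow> real"
  assumes P: "bilinear P" and Q: "bilinear Q" and V: "subspace V"
    and null: "\<And>v. v \<in> V \<Longrightarrow> P v v = 0 \<Longrightarrow> 0 \<le> Q v v"
    and v: "v \<in> V" "P v v > 0" and w: "w \<in> V" "P w w < 0"
  shows "0 \<le> Q w w * P v v - Q v v * P w w"
proof -
  define p n h where "p = P v v" and "n = - P w w" and "h = (P v w + P w v) / 2"
  have pn: "p > 0" "n > 0" using v w by (auto simp: p_def n_def)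
  define d where "d = sqrt (h\<^sup>2 + p * n)"
  have d2: "d\<^sup>2 = h\<^sup>2 + p * n" using pn by (simp add: d_def)
  have "d > \<bar>h\<bar>"
    unfolding d_def using pn by (intro real_less_rsqrt) simp
  define s1 s2 where "s1 = (h + d) / n" and "s2 = (h - d) / n"
  have s: "s1 > 0" "s2 < 0" using \<open>d > \<bar>h\<bar>\<close> pn by (auto simp: s1_def s2_def divide_simps)
  have prod: "n * (s1 * s2) = - p"
    using d2 pn by (simp add: s1_def s2_def field_simps power2_eq_square)
  \<comment> \<open>The equation for \<open>r\<close> says that v + r w is null for
    \<open>P\<close>; its roots are \<open>s1\<close> and \<open>s2\<close>.\<close>
  have cone: "0 \<le> Q v v + r * (Q v w + Q w v) + r\<^sup>2 * Q w w" if "n * r\<^sup>2 = p + 2 * h * r" for r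
  proof -
    have "P (v + r *\<^sub>R w) (v + r *\<^sub>R w) = 0"
      using that unfolding bilinear_line_expand[OF P] p_def n_def h_def by (simp add: field_simps)
    then have "0 \<le> Q (v + r *\<^sub>R w) (v + r *\<^sub>R w)"
      using null V v w by (simp add: subspace_add subspace_scale)
    then show ?thesis by (simp add: bilinear_line_expand[OF Q])
  qed
  have "n * s1\<^sup>2 = p + 2 * h * s1" "n * s2\<^sup>2 = p + 2 * h * s2"
    using d2 pn by (auto simp: s1_def s2_def field_simps power2_eq_square)
  note c1 = cone[OF this(1)] and c2 = cone[OF this(2)]
  define m where "m = Q v w + Q w v"
  have "0 \<le> (- s2) * (Q v v + s1 * m + s1\<^sup>2 * Q w w)"
    "0 \<le> s1 * (Q v v + s2 * m + s2\<^sup>2 * Q w w)"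
    using s c1 c2 unfolding m_def by (auto intro: mult_nonneg_nonneg mult_nonpos_nonneg)
  then have "0 \<le> n * ((- s2) * (Q v v + s1 * m + s1\<^sup>2 * Q w w)
      + s1 * (Q v v + s2 * m + s2\<^sup>2 * Q w w))"
    using pn by (simp only: add_nonneg_nonneg mult_nonneg_nonneg less_imp_le)
  also have "\<dots> = (s1 - s2) * (n * Q v v - n * (s1 * s2) * Q w w)"
    by (simp add: algebra_simps power2_eq_square)
  finally have "0 \<le> n * Q v v + p * Q w w"
    using s by (simp add: prod zero_le_mult_iff)
  then show ?thesis by (simp add: p_def n_def algebra_simps)
qed

text \<open>The conclusion asks that \<open>t\<close> be at least -Q/P wherever P > 0 and at most
  -Q/P wherever P < 0. By \<open>finsler_aux\<close> every such lower bound lies below every such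
  upper bound, so the supremum of the lower bounds serves; \<open>v0\<close> and \<open>w0\<close>
  make it exist.\<close>

lemma finsler:
  fixes P Q :: "'a::real_vector \<Rightarrow> 'a \<Rightarrow> real"
  assumes P: "bilinear P" and Q: "bilinear Q" and V: "subspace V"
    and null: "\<And>v. v \<in> V \<Longrightarrow> P v v = 0 \<Longrightarrow> 0 \<le> Q v v"
    and v0: "v0 \<in> V" "P v0 v0 > 0" and w0: "w0 \<in> V" "P w0 w0 < 0"
  obtains t where "\<And>v. v \<in> V \<Longrightarrow> 0 \<le> Q v v + t * P v v"
proof -
  define L where "L = (\<lambda>v. - Q v v / P v v) ` {v \<in> V. P v v > 0}"
  have le: "- Q v v / P v v \<le> - Q w w / P w w" if "v \<in> V" "P v v > 0" "w \<in> V" "P w w < 0" for v w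
    using finsler_aux[OF P Q V null that] that by (simp add: divide_simps algebra_simps)
  have bdd: "bdd_above L"
    unfolding L_def by (rule bdd_aboveI2[where M = "- Q w0 w0 / P w0 w0"]) (use le[OF _ _ w0] in blast)
  have ne: "L \<noteq> {}" using v0 by (auto simp: L_def)
  show thesis
  proof (rule that[of "Sup L"])
    fix v assume v: "v \<in> V"
    consider "P v v = 0" | "P v v > 0" | "P v v < 0" by linarith
    then show "0 \<le> Q v v + Sup L * P v v"
    proof cases
      case 1
      then show ?thesis using null v by simp
    next
      case 2
      then have "- Q v v / P v v \<le> Sup L"
        using v by (intro cSup_upper bdd) (auto simp: L_def)
      then show ?thesis using 2 by (simp add: divide_simps algebra_simps)
    next
      case 3
      then have "Sup L \<le> - Q v v / P v v"
        using v le by (intro cSup_least ne) (auto simp: L_def)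
      then show ?thesis using 3 by (simp add: divide_simps algebra_simps)
    qed
  qed
qed

section \<open>Bivectors\<close>

lemma bilinear_bivec_inner: "bilinear bivec_inner"
  by (auto simp: bilinear_def bivec_inner_def inner_simps intro!: linearI)

lemma bivectors_iff: "A \<in> bivectors \<longleftrightarrow> (\<forall>i j. A $ j $ i = - A $ i $ j)"
  unfolding bivectors_def transpose_def vec_eq_iff mem_Collect_eq uminus_vec_def vec_lambda_beta
  by (rule refl)

lemma bivectorsD: "A \<in> bivectors \<Longrightarrow> A $ j $ i = - A $ i $ j"
  unfolding bivectors_iff by blast

lemma subspace_bivectors: "subspace bivectors"
proof (rule subspaceI)
  show "0 \<in> bivectors" by (simp add: bivectors_iff)
  fix A B and r :: real assume A: "A \<in> bivectors"
  show "r *\<^sub>R A \<in> bivectors"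
    unfolding bivectors_iff
  proof (intro allI)
    fix i j
    show "(r *\<^sub>R A) $ j $ i = - (r *\<^sub>R A) $ i $ j"
      by (subst vector_scaleR_component, subst vector_scaleR_component, subst bivectorsD[OF A, of j i]) simp
  qed
  assume B: "B \<in> bivectors"
  show "A + B \<in> bivectors"
    unfolding bivectors_iff
  proof (intro allI)
    fix i j
    show "(A + B) $ j $ i = - (A + B) $ i $ j"
      by (subst vector_add_component, subst vector_add_component,
          subst bivectorsD[OF A, of j i], subst bivectorsD[OF B, of j i]) simp
  qed
qed

lemma linear_hodge_star: "linear hodge_star"
proof -
  have "bounded_linear (\<lambda>A::real^4^4. A $ i $ j *\<^sub>R W)" for i j and W :: "real^4^4"
    by (intro bounded_linear_scaleR_const bounded_linear_compose[OF bounded_linear_vec_nth bounded_linear_vec_nth])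
  then show ?thesis
    unfolding hodge_star_def Let_def
    by (intro bounded_linear.linear bounded_linear_add bounded_linear_sub)
qed

lemma wedge_bivectors: "wedge v w \<in> bivectors"
  by (simp add: bivectors_def wedge_def transpose_def vec_eq_iff)

lemma wedge_inner: "wedge v w \<bullet> B = v \<bullet> (B *v w) - w \<bullet> (B *v v)"
  by (simp add: wedge_def inner_vec_def matrix_vector_mult_def sum_distrib_left
      sum_subtractf[symmetric] algebra_simps)

lemma wedge_mult_vec: "wedge v w *v z = (w \<bullet> z) *\<^sub>R v - (v \<bullet> z) *\<^sub>R w"
  by (simp add: wedge_def inner_vec_def matrix_vector_mult_def vec_eq_iff sum_distrib_right
      left_diff_distrib sum_subtractf) (simp add: mult_ac)

lemma bivec_inner_wedge:
  "bivec_inner (wedge v w) (wedge v w) = (v \<bullet> v) * (w \<bullet> w) - (v \<bullet> w)\<^sup>2"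
  by (simp add: bivec_inner_def wedge_inner wedge_mult_vec inner_diff_right inner_commute power2_eq_square)

lemma bivec_inner_wedge_axis:
  assumes "B \<in> bivectors"
  shows "bivec_inner (wedge (axis p 1) (axis q 1)) B = B $ p $ q"
proof -
  have "bivec_inner (wedge (axis p 1) (axis q 1)) B = (B $ p $ q - B $ q $ p) / 2"
    by (simp add: bivec_inner_def wedge_inner inner_axis' matrix_vector_mult_basis column_def)
  also have "B $ q $ p = - B $ p $ q" by (rule bivectorsD[OF assms])
  finally show ?thesis by simp
qed

text \<open>The right-hand side is symmetric in \<open>A\<close> and \<open>B\<close>, so the star
  is self-adjoint on bivectors; for A = B it is twice the Pfaffian.\<close>

lemma bivec_inner_hodge_star:
  assumes "B \<in> bivectors"
  shows "bivec_inner (hodge_star A) B =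
    A $ 1 $ 2 * B $ 3 $ 4 - A $ 1 $ 3 * B $ 2 $ 4 + A $ 1 $ 4 * B $ 2 $ 3
    + A $ 2 $ 3 * B $ 1 $ 4 - A $ 2 $ 4 * B $ 1 $ 3 + A $ 3 $ 4 * B $ 1 $ 2"
  unfolding hodge_star_def Let_def
  by (simp add: bilinear_ladd[OF bilinear_bivec_inner] bilinear_lsub[OF bilinear_bivec_inner]
      bilinear_lmul[OF bilinear_bivec_inner] bivec_inner_wedge_axis[OF assms])

lemma bivec_inner_commute: "bivec_inner A B = bivec_inner B A"
  by (simp add: bivec_inner_def inner_commute)

text \<open>Eigenspaces of a self-adjoint map for different eigenvalues are orthogonal.\<close>

lemma bivec_inner_plus_minus:
  assumes "A \<in> bivectors_plus" "B \<in> bivectors_minus"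
  shows "bivec_inner A B = 0"
proof -
  have A: "A \<in> bivectors" "hodge_star A = A" and B: "B \<in> bivectors" "hodge_star B = - B"
    using assms by (simp_all add: bivectors_plus_def bivectors_minus_def)
  have "bivec_inner (hodge_star A) B = bivec_inner (hodge_star B) A"
    unfolding bivec_inner_hodge_star[OF A(1)] bivec_inner_hodge_star[OF B(1)] by simp
  then have "bivec_inner A B = - bivec_inner A B"
    unfolding A(2) B(2) by (simp add: bivec_inner_def inner_commute)
  then show ?thesis by simp
qed

section \<open>Null bivectors are decomposable\<close>

text \<open>Each choice of the four indices gives either a consequence of skew-symmetry or, up to
  sign, the vanishing of the Pfaffian.\<close>

lemma plucker_relation:
  assumes A: "A \<in> bivectors" and null: "bivec_inner (hodge_star A) A = 0"
  shows "A $ p $ i * A $ q $ j - A $ p $ j * A $ q $ i = A $ p $ q * A $ i $ j"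
proof -
  have diag: "A $ i $ i = 0" for i using bivectorsD[OF A, of i i] by linarith
  note skew = bivectorsD[OF A, of 2 1] bivectorsD[OF A, of 3 1] bivectorsD[OF A, of 4 1]
      bivectorsD[OF A, of 3 2] bivectorsD[OF A, of 4 2] bivectorsD[OF A, of 4 3]
  have pl: "A $ 1 $ 2 * A $ 3 $ 4 - A $ 1 $ 3 * A $ 2 $ 4 + A $ 1 $ 4 * A $ 2 $ 3 = 0"
    using null unfolding bivec_inner_hodge_star[OF A] by (simp add: mult.commute)
  show ?thesis
    using exhaust_4[of p] exhaust_4[of q] exhaust_4[of i] exhaust_4[of j]
    apply (elim disjE; hypsubst; simp only: skew diag mult_zero_left mult_zero_right minus_zero
        diff_0 diff_0_right mult_minus_left mult_minus_right minus_minus diff_self)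
    using pl by (simp_all add: mult.commute)
qed

lemma bivector_null_decomposable:
  assumes A: "A \<in> bivectors" and null: "bivec_inner (hodge_star A) A = 0"
  obtains v w where "A = wedge v w"
proof (cases "A = 0")
  case True
  then have "A = wedge 0 0" by (simp add: wedge_def vec_eq_iff)
  then show ?thesis by (rule that)
next
  case False
  then obtain p q where pq: "A $ p $ q \<noteq> 0" by (auto simp: vec_eq_iff)
  \<comment> \<open>A null bivector is recovered from two of its rows: the 2x2 minors of rows
    \<open>p\<close> and \<open>q\<close> are the entries of \<open>A\<close> scaled by
    \<open>A $ p $ q\<close>.\<close>
  have "wedge (A $ p /\<^sub>R A $ p $ q) (A $ q) $ i $ j = A $ i $ j" for i j
  proof -
    have "wedge (A $ p /\<^sub>R A $ p $ q) (A $ q) $ i $ j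
        = (A $ p $ i * A $ q $ j - A $ p $ j * A $ q $ i) / A $ p $ q"
      by (simp add: wedge_def divide_inverse algebra_simps)
    also have "\<dots> = A $ i $ j"
      unfolding plucker_relation[OF assms] using pq by simp
    finally show ?thesis .
  qed
  then have "A = wedge (A $ p /\<^sub>R A $ p $ q) (A $ q)"
    unfolding vec_eq_iff by metis
  then show ?thesis by (rule that)
qed

section \<open>The curvature operator\<close>

lemma bivec_inner_orthonormal:
  assumes e: "orthonormal_basis_of bivectors_plus e" and f: "orthonormal_basis_of bivectors_minus f"
  shows "bivec_inner (e i) (e j) = (if i = j then 1 else 0)"
    and "bivec_inner (f i) (f j) = (if i = j then 1 else 0)"
    and "bivec_inner (e i) (f j) = 0" and "bivec_inner (f j) (e i) = 0"
    and "hodge_star (e i) = e i" and "hodge_star (f i) = - f i"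
    and "e i \<in> bivectors" and "f i \<in> bivectors"
proof -
  have ei: "e i \<in> bivectors_plus" for i
    using e span_base[of "e i" "range e"] by (simp add: orthonormal_basis_of_def)
  have fi: "f i \<in> bivectors_minus" for i
    using f span_base[of "f i" "range f"] by (simp add: orthonormal_basis_of_def)
  show "bivec_inner (e i) (f j) = 0" by (rule bivec_inner_plus_minus[OF ei fi])
  then show "bivec_inner (f j) (e i) = 0" by (simp add: bivec_inner_commute)
  show "hodge_star (e i) = e i" "hodge_star (f i) = - f i" "e i \<in> bivectors" "f i \<in> bivectors"
    using ei[of i] fi[of i] by (auto simp: bivectors_plus_def bivectors_minus_def)
  show "bivec_inner (e i) (e j) = (if i = j then 1 else 0)"
    "bivec_inner (f i) (f j) = (if i = j then 1 else 0)"
    using e f by (auto simp: orthonormal_basis_of_def)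
qed

text \<open>The sign \<open>s\<close> treats lower and upper curvature bounds simultaneously.\<close>

lemma canonical_form_bound:
  assumes R: "linear R" and can: "canonical_form R u wp wm C" and s: "s\<^sup>2 = 1"
    and psd: "psd_on_bivectors (\<lambda>A. s *\<^sub>R (R A - k *\<^sub>R A) + t *\<^sub>R hodge_star A)"
  shows "(\<Sum>i\<in>UNIV. \<Sum>j\<in>UNIV. (C $ i $ j)\<^sup>2) \<le> 3 * (u - k)\<^sup>2 - 3 * t\<^sup>2 + wp \<bullet> wm"
proof -
  from can obtain e f where e: "orthonormal_basis_of bivectors_plus e"
    and f: "orthonormal_basis_of bivectors_minus f"
    and Re: "\<And>j. R (e j) = (u + wp $ j) *\<^sub>R e j + (\<Sum>i\<in>UNIV. C $ i $ j *\<^sub>R f i)"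
    and Rf: "\<And>j. R (f j) = (\<Sum>i\<in>UNIV. C $ j $ i *\<^sub>R e i) + (u + wm $ j) *\<^sub>R f j"
    and ord: "wp $ 1 \<le> wp $ 2" "wp $ 2 \<le> wp $ 3" "wm $ 1 \<le> wm $ 2" "wm $ 2 \<le> wm $ 3"
    and zero: "wp $ 1 + wp $ 2 + wp $ 3 = 0" "wm $ 1 + wm $ 2 + wm $ 3 = 0"
    unfolding canonical_form_def by blast
  note on = bivec_inner_orthonormal[OF e f]
  \<comment> \<open>The blocks of s(R - k Id) + t*: the star adds t on the self-dual side and
    subtracts it on the anti-self-dual side.\<close>
  define a b where "a j = s * (u + wp $ j - k) + t" and "b j = s * (u + wm $ j - k) - t" for j
  define c where "c i j = s * C $ i $ j" for i j
  have inner_sum_left: "bivec_inner (sum g UNIV) B = (\<Sum>i\<in>UNIV. bivec_inner (g i) B)" for g :: "3 \<Rightarrow> _" and B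
    by (simp add: bivec_inner_def inner_sum_left sum_divide_distrib)
  note bil = bilinear_ladd[OF bilinear_bivec_inner] bilinear_lsub[OF bilinear_bivec_inner]
    bilinear_lneg[OF bilinear_bivec_inner] bilinear_lmul[OF bilinear_bivec_inner] inner_sum_left
  have "0 \<le> block_form a b c x y" for x y
  proof -
    define A where "A = (\<Sum>j\<in>UNIV. x j *\<^sub>R e j) + (\<Sum>j\<in>UNIV. y j *\<^sub>R f j)"
    define S where "S = s *\<^sub>R (R A - k *\<^sub>R A) + t *\<^sub>R hodge_star A"
    have A: "A \<in> bivectors" unfolding A_def
      by (intro subspace_add subspace_sum subspace_scale subspace_bivectors on)
    have R_A: "R A = (\<Sum>j\<in>UNIV. x j *\<^sub>R R (e j)) + (\<Sum>j\<in>UNIV. y j *\<^sub>R R (f j))"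
      by (simp add: A_def linear_add[OF R] linear_sum[OF R] linear_scale[OF R])
    have star: "hodge_star A = (\<Sum>j\<in>UNIV. x j *\<^sub>R e j) - (\<Sum>j\<in>UNIV. y j *\<^sub>R f j)"
      by (simp add: A_def linear_add[OF linear_hodge_star] linear_sum[OF linear_hodge_star]
          linear_scale[OF linear_hodge_star] on sum_negf)
    have Se: "bivec_inner S (e l) = a l * x l + (\<Sum>i\<in>UNIV. c i l * y i)" for l
      unfolding S_def R_A star Re Rf unfolding A_def
      by (simp add: bil on if_distrib[of "\<lambda>x. _ * x"] sum.distrib sum_distrib_left a_def c_def
          algebra_simps cong: if_cong)
    have Sf: "bivec_inner S (f l) = b l * y l + (\<Sum>j\<in>UNIV. c l j * x j)" for l
      unfolding S_def R_A star Re Rf unfolding A_def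
      by (simp add: bil on if_distrib[of "\<lambda>x. _ * x"] sum.distrib sum_distrib_left b_def c_def
          algebra_simps cong: if_cong)
    have "bivec_inner S A = (\<Sum>l\<in>UNIV. x l * bivec_inner S (e l)) + (\<Sum>l\<in>UNIV. y l * bivec_inner S (f l))"
      unfolding bivec_inner_commute[of S] by (simp add: A_def bil)
    also have "\<dots> = block_form a b c x y"
    proof -
      have "(\<Sum>l\<in>UNIV. \<Sum>i\<in>UNIV. x l * (c i l * y i)) = (\<Sum>i\<in>UNIV. \<Sum>j\<in>UNIV. c i j * y i * x j)"
        by (subst sum.swap) (simp add: mult_ac)
      moreover have "(\<Sum>l\<in>UNIV. \<Sum>j\<in>UNIV. y l * (c l j * x j)) = (\<Sum>i\<in>UNIV. \<Sum>j\<in>UNIV. c i j * y i * x j)"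
        by (simp add: mult_ac)
      ultimately show ?thesis
        by (simp add: Se Sf block_form_def distrib_left sum.distrib sum_distrib_left power2_eq_square mult_ac)
    qed
    finally show ?thesis using psd A unfolding psd_on_bivectors_def S_def by metis
  qed
  \<comment> \<open>Both \<open>wp\<close> and \<open>wm\<close> increase with the index. The sign s
    = -1 reverses both orders, so \<open>a\<close> and \<open>b\<close> stay similarly
    ordered.\<close>
  moreover have "b i \<le> b j" if "a i < a j" for i j
  proof -
    have mono: "wm $ i \<le> wm $ j" if "wp $ i < wp $ j" for i j
    proof -
      have "\<forall>i j. wp $ i < wp $ j \<longrightarrow> wm $ i \<le> wm $ j" using ord by (simp add: forall_3)
      then show ?thesis using that by blast
    qed
    have "s = 1 \<or> s = -1" using s by (simp add: power2_eq_1_iff)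
    then show ?thesis using that mono[of i j] mono[of j i] by (auto simp: a_def b_def)
  qed
  ultimately have "(\<Sum>i\<in>UNIV. \<Sum>j\<in>UNIV. (c i j)\<^sup>2) \<le> (\<Sum>i\<in>UNIV. a i * b i)"
    by (rule psd_block_offdiag_bound)
  moreover have "(c i j)\<^sup>2 = (C $ i $ j)\<^sup>2" for i j
    by (simp add: c_def power_mult_distrib s)
  moreover have "(\<Sum>i\<in>UNIV. a i * b i) = 3 * (u - k)\<^sup>2 - 3 * t\<^sup>2 + wp \<bullet> wm"
  proof -
    \<comment> \<open>Summed over \<open>i\<close>, the terms linear in the entries of
      \<open>wp\<close> and \<open>wm\<close> cancel because these sum to zero.\<close>
    have ab: "a i * b i = s\<^sup>2 * ((u - k)\<^sup>2 + (u - k) * (wp $ i + wm $ i) + wp $ i * wm $ i)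
        - t\<^sup>2 + s * t * (wm $ i - wp $ i)" for i
      by (simp add: a_def b_def algebra_simps power2_eq_square)
    have w3: "wp $ 3 = - wp $ 1 - wp $ 2" "wm $ 3 = - wm $ 1 - wm $ 2" using zero by simp_all
    show ?thesis unfolding ab s
      by (simp add: sum_3 inner_vec_def w3 algebra_simps)
  qed
  ultimately show ?thesis by simp
qed

text \<open>For independent \<open>v\<close>, \<open>w\<close> the form of \<open>R\<close> at their
  wedge is the sectional curvature of the image plane times the squared area \<open>n\<close>, which
  is the Gram determinant in the denominator of \<open>sec\<close>. For dependent ones the wedge is
  0.\<close>

lemma curvature_operator_wedge:
  assumes iso: "tangent_isometry (G x) E" and curv: "is_curvature_operator G x E R"
    and sec: "\<And>X Y. X \<noteq> Y \<Longrightarrow> independent {X, Y} \<Longrightarrow> 0 \<le> s * (sec G x X Y - k)"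
  shows "0 \<le> s * (bivec_inner (R (wedge v w)) (wedge v w) - k * bivec_inner (wedge v w) (wedge v w))"
proof (cases "wedge v w = 0")
  case True
  then show ?thesis using curv
    by (simp add: is_curvature_operator_def linear_0 bivec_inner_def)
next
  case False
  then have "v \<noteq> w" "v \<noteq> 0" and not_multiple: "w \<noteq> r *\<^sub>R v" for r
    by (auto simp: wedge_def vec_eq_iff[of "vec_lambda _"])
  moreover have "w \<notin> span {v}"
    using not_multiple by (auto simp: span_singleton)
  ultimately have indep: "independent {v, w}"
    by (simp add: insert_commute[of v] independent_insert)
  have E: "linear E" and gram: "\<And>v w. gram (G x) (E v) (E w) = v \<bullet> w"
    using iso by (auto simp: tangent_isometry_def)
  have inj: "inj E"
  proof (rule linear_injective_0[THEN iffD2, OF E], intro allI impI)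
    fix v assume "E v = 0"
    then have "v \<bullet> v = 0" using gram[of v v] by (simp add: gram_def)
    then show "v = 0" by simp
  qed
  have "independent (E ` {v, w})"
    using indep inj_on_subset[OF inj] by (intro linear_independent_injective_image[OF E]) auto
  then have "0 \<le> s * (sec G x (E v) (E w) - k)"
    using \<open>v \<noteq> w\<close> inj by (intro sec) (auto dest: injD)
  moreover define n where "n = bivec_inner (wedge v w) (wedge v w)"
  have "n > 0" using False by (simp add: n_def bivec_inner_def)
  moreover have "bivec_inner (R (wedge v w)) (wedge v w) = n * sec G x (E v) (E w)"
    using curv \<open>n > 0\<close> unfolding is_curvature_operator_def sec_def gram
    by (simp add: n_def bivec_inner_wedge)
  ultimately have "0 \<le> n * (s * (sec G x (E v) (E w) - k))"
    "bivec_inner (R (wedge v w)) (wedge v w) = n * sec G x (E v) (E w)" by simp_all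
  then show ?thesis unfolding n_def[symmetric] by (simp add: algebra_simps)
qed

text \<open>\<open>finsler\<close> is applied with the form of the star as \<open>P\<close> and that
  of s(R - k Id) as \<open>Q\<close>. Null bivectors of the star are wedges, so the bound on planes
  is nonnegativity of \<open>Q\<close> on the null cone.\<close>

lemma thorpe_trick:
  assumes R: "linear R"
    and planes: "\<And>v w. 0 \<le> s * (bivec_inner (R (wedge v w)) (wedge v w)
                  - k * bivec_inner (wedge v w) (wedge v w))"
  obtains t where "psd_on_bivectors (\<lambda>A. s *\<^sub>R (R A - k *\<^sub>R A) + t *\<^sub>R hodge_star A)"
proof -
  let ?P = "\<lambda>A B. bivec_inner (hodge_star A) B"
  let ?Q = "\<lambda>A B. bivec_inner (s *\<^sub>R (R A - k *\<^sub>R A)) B"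
  have P: "bilinear ?P"
    by (auto simp: bilinear_def bivec_inner_def inner_simps linear_add[OF linear_hodge_star]
        linear_scale[OF linear_hodge_star] add_divide_distrib intro!: linearI)
  have Q: "bilinear ?Q"
    by (auto simp: bilinear_def bivec_inner_def inner_simps linear_add[OF R]
        linear_scale[OF R] algebra_simps add_divide_distrib diff_divide_distrib intro!: linearI)
  have Q_eq: "?Q A A = s * (bivec_inner (R A) A - k * bivec_inner A A)" for A
    by (simp add: bivec_inner_def inner_simps algebra_simps diff_divide_distrib)
  have null: "0 \<le> ?Q A A" if "A \<in> bivectors" "?P A A = 0" for A
    using bivector_null_decomposable[OF that] planes Q_eq by metis
  define e :: "4 \<Rightarrow> real^4" where "e i = axis i 1" for i
  \<comment> \<open>A self-dual and an anti-self-dual bivector, showing that the form of the star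
    takes both signs.\<close>
  define Ap Am where "Ap = wedge (e 1) (e 2) + wedge (e 3) (e 4)"
    and "Am = wedge (e 1) (e 2) - wedge (e 3) (e 4)"
  have Ap: "Ap \<in> bivectors" and Am: "Am \<in> bivectors"
    by (simp_all add: Ap_def Am_def subspace_add subspace_diff subspace_bivectors wedge_bivectors)
  have "?P Ap Ap > 0"
    unfolding bivec_inner_hodge_star[OF Ap] by (simp add: Ap_def wedge_def e_def axis_def)
  moreover have "?P Am Am < 0"
    unfolding bivec_inner_hodge_star[OF Am] by (simp add: Am_def wedge_def e_def axis_def)
  ultimately obtain t where "\<And>A. A \<in> bivectors \<Longrightarrow> 0 \<le> ?Q A A + t * ?P A A"
    using finsler[OF P Q subspace_bivectors null Ap _ Am] by blast
  then show thesis
    by (intro that[of t]) (simp add: psd_on_bivectors_def bilinear_ladd[OF bilinear_bivec_inner]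
        bilinear_lmul[OF bilinear_bivec_inner])
qed

theorem proposition5p3:
  fixes X :: "'a topology" and \<A> :: "'a chart set"
    and g :: "'a chart \<Rightarrow> real^4 \<Rightarrow> real^4^4"
    and c :: "'a chart" and p :: 'a
    and E :: "real^4 \<Rightarrow> real^4"
    and R :: "real^4^4 \<Rightarrow> real^4^4"
    and k u :: real and wp wm :: "real^3" and C :: "real^3^3"
  assumes "riemannian_4_manifold X \<A> g"
    and "c \<in> \<A>" and "p \<in> fst c"
    and "tangent_isometry (g c (snd c p)) E"
    and "is_curvature_operator (g c) (snd c p) E R"
    and "canonical_form R u wp wm C"
  shows "((sec_ge (g c) (snd c p) k \<or> sec_le (g c) (snd c p) k) \<longrightarrow>
            (\<Sum>i\<in>UNIV. \<Sum>j\<in>UNIV. (C $ i $ j)\<^sup>2) \<le> 3 * (u - k)\<^sup>2 + wp \<bullet> wm) \<and>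
         (\<forall>t::real.
            (psd_on_bivectors (\<lambda>A. R A - k *\<^sub>R A + t *\<^sub>R hodge_star A) \<or>
             psd_on_bivectors (\<lambda>A. - (R A - k *\<^sub>R A) + t *\<^sub>R hodge_star A)) \<longrightarrow>
            (\<Sum>i\<in>UNIV. \<Sum>j\<in>UNIV. (C $ i $ j)\<^sup>2) \<le> 3 * (u - k)\<^sup>2 - 3 * t\<^sup>2 + wp \<bullet> wm)"
proof -
  let ?R = "\<lambda>s t A. s *\<^sub>R (R A - k *\<^sub>R A) + t *\<^sub>R hodge_star A"
  have R: "linear R" using assms(5) by (simp add: is_curvature_operator_def)
  note bound = canonical_form_bound[OF R assms(6)]
  have planes: "(\<Sum>i\<in>UNIV. \<Sum>j\<in>UNIV. (C $ i $ j)\<^sup>2) \<le> 3 * (u - k)\<^sup>2 + wp \<bullet> wm"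
    if s: "s\<^sup>2 = 1" and sec: "\<And>X Y. X \<noteq> Y \<Longrightarrow> independent {X, Y} \<Longrightarrow> 0 \<le> s * (sec (g c) (snd c p) X Y - k)"
    for s
  proof -
    obtain t where "psd_on_bivectors (?R s t)"
      using thorpe_trick[OF R curvature_operator_wedge[OF assms(4,5) sec]] by blast
    then have "(\<Sum>i\<in>UNIV. \<Sum>j\<in>UNIV. (C $ i $ j)\<^sup>2) \<le> 3 * (u - k)\<^sup>2 - 3 * t\<^sup>2 + wp \<bullet> wm"
      by (rule bound[OF s])
    then show ?thesis using zero_le_power2[of t] by linarith
  qed
  show ?thesis
  proof (intro conjI impI allI; elim disjE)
    assume "sec_ge (g c) (snd c p) k"
    then show "(\<Sum>i\<in>UNIV. \<Sum>j\<in>UNIV. (C $ i $ j)\<^sup>2) \<le> 3 * (u - k)\<^sup>2 + wp \<bullet> wm"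
      by (intro planes[of 1]) (auto simp: sec_ge_def)
  next
    assume "sec_le (g c) (snd c p) k"
    then show "(\<Sum>i\<in>UNIV. \<Sum>j\<in>UNIV. (C $ i $ j)\<^sup>2) \<le> 3 * (u - k)\<^sup>2 + wp \<bullet> wm"
      by (intro planes[of "-1"]) (auto simp: sec_le_def)
  next
    fix t assume "psd_on_bivectors (\<lambda>A. R A - k *\<^sub>R A + t *\<^sub>R hodge_star A)"
    then show "(\<Sum>i\<in>UNIV. \<Sum>j\<in>UNIV. (C $ i $ j)\<^sup>2) \<le> 3 * (u - k)\<^sup>2 - 3 * t\<^sup>2 + wp \<bullet> wm"
      by (intro bound[of 1]) auto
  next
    fix t assume "psd_on_bivectors (\<lambda>A. - (R A - k *\<^sub>R A) + t *\<^sub>R hodge_star A)"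
    then show "(\<Sum>i\<in>UNIV. \<Sum>j\<in>UNIV. (C $ i $ j)\<^sup>2) \<le> 3 * (u - k)\<^sup>2 - 3 * t\<^sup>2 + wp \<bullet> wm"
      by (intro bound[of "-1"]) auto
  qed
qed

end
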